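(* Consider a sequence of clique detection problems indexed by $N\to\infty$ with clique size $n=n_N$ and background connection probability $p_0=p_{0,N}$ (and $p_1=1$), satisfying the standing assumptions of the context. If $$\binom{N}{n}\, p_0^{\frac{n(n-1)}{2}} \to 0 ,$$ then the clique number test is asymptotically powerful: there is a sequence of thresholds $c_N$ such that the test $T_N$ which rejects ($T_N=1$) if and only if the clique number of the observed graph is at least $c_N$ satisfies $\gamma_N(T_N)\to 0$.
   Context: Observed data: the adjacency matrix $\boldsymbol{W}=(W_{i,j})\in\{0,1\}^{N\times N}$ (symmetric, zero diagonal) of a random undirected graph on the node set $\{1,\dots,N\}$. Under $\mathbb{P}_0$ (null), the $W_{i,j}$, $i<j$, are i.i.d. Bernoulli$(p_0)$ with $p_0\in(0,1)$. For $S\subset\{1,\dots,N\}$ with $|S|=n$, under $\mathbb{P}_S$ (alternative), the $W_{i,j}$, $i<j$, are independent, $W_{i,j}=1$ almost surely if $i,j\in S$ (so $S$ is a clique), and $\mathbb{P}_S(W_{i,j}=1)=p_0$ otherwise. A test $T$ is a function of $\boldsymbol{W}$ with values in $\{0,1\}$, and its risk is $\gamma_N(T)=\mathbb{P}_0(T=1)+\max_{|S|=n}\mathbb{P}_S(T=0)$. The clique number of a graph is the size of its largest clique; the clique number test rejects for large values of it. Standing assumptions: $N\to\infty$; $n$ and $p_0$ may depend on $N$ ($n$ need not tend to infinity); $n/N\to 0$; $p_0$ is bounded away from $1$; $N^2p_0\to\infty$. *)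

theory Defs
  imports "HOL-Probability.Probability" "HOL-Library.Ramsey"
begin

type_synonym adj_matrix = "nat \<Rightarrow> nat \<Rightarrow> nat"

definition node_pairs :: "nat \<Rightarrow> (nat \<times> nat) set" where
  "node_pairs N = {(i, j). 1 \<le> i \<and> i < j \<and> j \<le> N}"

text \<open>The symmetric, zero-diagonal 0/1 matrix whose entries above the diagonal are given by \<open>\<omega>\<close>.\<close>

definition sym_matrix :: "(nat \<times> nat \<Rightarrow> bool) \<Rightarrow> adj_matrix" where
  "sym_matrix \<omega> = (\<lambda>i j. if i < j then of_bool (\<omega> (i, j))
                           else if j < i then of_bool (\<omega> (j, i)) else 0)"

text \<open>Law of the adjacency matrix on the nodes \<open>{1..N}\<close> when the entries above the diagonal are
  independent and the one at position \<open>e\<close> is Bernoulli with parameter \<open>q e\<close>. Entries with an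
  index outside \<open>{1..N}\<close> are \<open>0\<close>.\<close>

definition graph_law :: "nat \<Rightarrow> (nat \<times> nat \<Rightarrow> real) \<Rightarrow> adj_matrix pmf" where
  "graph_law N q = map_pmf sym_matrix (Pi_pmf (node_pairs N) False (\<lambda>e. bernoulli_pmf (q e)))"

definition null_law :: "nat \<Rightarrow> real \<Rightarrow> adj_matrix pmf" where
  "null_law N p = graph_law N (\<lambda>_. p)"

definition clique_law :: "nat \<Rightarrow> real \<Rightarrow> nat set \<Rightarrow> adj_matrix pmf" where
  "clique_law N p S = graph_law N (\<lambda>(i, j). if i \<in> S \<and> j \<in> S then 1 else p)"

text \<open>\<open>Max\<close> is unspecified on the empty set, so the risk is only meaningful for \<open>n \<le> N\<close>.\<close>

definition risk :: "nat \<Rightarrow> nat \<Rightarrow> real \<Rightarrow> (adj_matrix \<Rightarrow> nat) \<Rightarrow> real" where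
  "risk N n p T =
     measure_pmf.prob (null_law N p) {W. T W = 1} +
     (MAX S\<in>{S. S \<subseteq> {1..N} \<and> card S = n}. measure_pmf.prob (clique_law N p S) {W. T W = 0})"

definition edges :: "nat \<Rightarrow> adj_matrix \<Rightarrow> nat set set" where
  "edges N W = {{i, j} | i j. i \<in> {1..N} \<and> j \<in> {1..N} \<and> W i j = 1}"

definition clique_number :: "nat \<Rightarrow> adj_matrix \<Rightarrow> nat" where
  "clique_number N W = Max (card ` {K. K \<subseteq> {1..N} \<and> clique K (edges N W)})"

definition clique_number_test :: "nat \<Rightarrow> nat \<Rightarrow> adj_matrix \<Rightarrow> nat" where
  "clique_number_test N c W = (if clique_number N W \<ge> c then 1 else 0)"

end

(* The threshold is the planted clique size n itself: a planted clique is never missed, and under the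
   null the expected number of n-cliques bounds the probability that there is one. *)
theory Submission
  imports Defs
begin

text \<open>Take the threshold equal to the planted size n. Under the alternative all pairs inside S
  are joined almost surely, so S is itself a clique of size n and the test never misses it
  (\<open>prob_clique_law_clique_number_less\<close>). Under the null a fixed n-set is a clique with
  probability p^(n(n-1)/2), by independence of its edges (\<open>prob_null_clique\<close>), and a
  union bound over the N choose n such sets controls the false alarms
  (\<open>prob_null_clique_number_ge\<close>). For n \<le> N the risk therefore lies between 0 and
  exactly the quantity assumed to vanish; n/N \<rightarrow> 0 gives n \<le> N eventually, and a
  sandwich concludes.\<close>

text \<open>Each potential edge inside K appears once, in the orientation in which
  \<open>sym_matrix\<close> reads \<omega>, so distinct elements are distinct independent
  coordinates of the random graph.\<close>

definition increasing_pairs :: "nat set \<Rightarrow> (nat \<times> nat) set" where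
  "increasing_pairs K = {(i, j). i \<in> K \<and> j \<in> K \<and> i < j}"

lemma card_increasing_pairs:
  assumes "finite K"
  shows "card (increasing_pairs K) = card K * (card K - 1) div 2"
proof -
  let ?P = "increasing_pairs K" and ?D = "(\<lambda>i. (i, i)) ` K"
  have sub: "?P \<subseteq> K \<times> K"
    by (auto simp: increasing_pairs_def)
  have fin: "finite ?P"
    using finite_subset[OF sub] assms by blast
  \<comment> \<open>The square is split into its diagonal, the pairs above it and their mirror
    images.\<close>
  have "K \<times> K = ?D \<union> (?P \<union> prod.swap ` ?P)"
    by (auto simp: increasing_pairs_def image_iff)
  moreover have "?P \<inter> prod.swap ` ?P = {}" "?D \<inter> (?P \<union> prod.swap ` ?P) = {}"
    by (auto simp: increasing_pairs_def)
  ultimately have "card (K \<times> K) = card ?D + (card ?P + card (prod.swap ` ?P))"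
    using assms fin by (simp add: card_Un_disjoint)
  also have "\<dots> = card K + 2 * card ?P"
    by (simp add: card_image[OF inj_swap] card_image[of "\<lambda>i. (i, i)"] inj_on_def)
  finally have "card K * card K = card K + 2 * card ?P"
    by (simp add: card_cartesian_product)
  then have "card K * (card K - 1) = 2 * card ?P"
    by (simp add: diff_mult_distrib2)
  then show ?thesis
    by simp
qed

lemma finite_node_pairs: "finite (node_pairs N)"
  by (rule finite_subset[of _ "{1..N} \<times> {1..N}"]) (auto simp: node_pairs_def)

lemma increasing_pairs_subset_node_pairs:
  "K \<subseteq> {1..N} \<Longrightarrow> increasing_pairs K \<subseteq> node_pairs N"
  by (auto simp: increasing_pairs_def node_pairs_def)

lemma edge_sym_matrix_iff:
  assumes "i \<in> {1..N}" "j \<in> {1..N}" "i < j"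
  shows "{i, j} \<in> edges N (sym_matrix \<omega>) \<longleftrightarrow> \<omega> (i, j)"
proof -
  \<comment> \<open>The set {i, j} does not remember an order, so membership may come from either
    entry; both entries equal the same coordinate of \<omega>.\<close>
  have "{i, j} \<in> edges N (sym_matrix \<omega>) \<longleftrightarrow> sym_matrix \<omega> i j = 1 \<or> sym_matrix \<omega> j i = 1"
    unfolding edges_def mem_Collect_eq doubleton_eq_iff using assms(1,2) by blast
  then show ?thesis
    using assms(3) by (simp add: sym_matrix_def)
qed

lemma clique_sym_matrix_iff:
  assumes "K \<subseteq> {1..N}"
  shows "clique K (edges N (sym_matrix \<omega>)) \<longleftrightarrow> (\<forall>e\<in>increasing_pairs K. \<omega> e)"
proof
  assume "clique K (edges N (sym_matrix \<omega>))"
  then have "{i, j} \<in> edges N (sym_matrix \<omega>)" if "i \<in> K" "j \<in> K" "i < j" for i j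
    using that by (simp add: clique_def)
  then show "\<forall>e\<in>increasing_pairs K. \<omega> e"
    using assms by (auto simp: increasing_pairs_def subset_iff edge_sym_matrix_iff)
next
  assume *: "\<forall>e\<in>increasing_pairs K. \<omega> e"
  have less: "{i, j} \<in> edges N (sym_matrix \<omega>)" if "i \<in> K" "j \<in> K" "i < j" for i j
    using * that assms by (subst edge_sym_matrix_iff) (auto simp: increasing_pairs_def)
  show "clique K (edges N (sym_matrix \<omega>))"
    unfolding clique_def
  proof (intro ballI impI)
    fix i j assume "i \<in> K" "j \<in> K" "i \<noteq> j"
    then show "{i, j} \<in> edges N (sym_matrix \<omega>)"
      using less[of i j] less[of j i] by (cases "i < j") (auto simp: insert_commute)
  qed
qed

text \<open>A subset of a clique is a clique, so a larger clique can be trimmed to exactly c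
  vertices. This lets the union bound range over sets of one size only.\<close>

lemma clique_number_ge_iff:
  "clique_number N W \<ge> c \<longleftrightarrow> (\<exists>K\<subseteq>{1..N}. card K = c \<and> clique K (edges N W))"
proof -
  let ?C = "{K. K \<subseteq> {1..N} \<and> clique K (edges N W)}"
  have "{} \<in> ?C"
    by (simp add: clique_def)
  then have ne: "card ` ?C \<noteq> {}"
    by blast
  have "clique_number N W \<ge> c \<longleftrightarrow> (\<exists>K\<in>?C. c \<le> card K)"
    unfolding clique_number_def using ne by (subst Max_ge_iff) auto
  also have "\<dots> \<longleftrightarrow> (\<exists>K\<subseteq>{1..N}. card K = c \<and> clique K (edges N W))"
  proof
    assume "\<exists>K\<in>?C. c \<le> card K"
    then obtain K where K: "K \<subseteq> {1..N}" "clique K (edges N W)" "c \<le> card K"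
      by blast
    obtain L where "L \<subseteq> K" "card L = c"
      using obtain_subset_with_card_n[OF K(3)] by blast
    with K show "\<exists>K\<subseteq>{1..N}. card K = c \<and> clique K (edges N W)"
      by (intro exI[of _ L]) (auto simp: clique_def)
  qed auto
  finally show ?thesis .
qed

lemma prob_null_clique:
  assumes "K \<subseteq> {1..N}" "0 \<le> p" "p \<le> 1"
  shows "measure_pmf.prob (null_law N p) {W. clique K (edges N W)} =
           p ^ (card K * (card K - 1) div 2)"
proof -
  let ?I = "increasing_pairs K"
  have sub: "?I \<subseteq> node_pairs N"
    by (rule increasing_pairs_subset_node_pairs[OF assms(1)])
  \<comment> \<open>Being a clique is a product event: the coordinates inside K are forced to be
    \<open>True\<close>, all others are free. Its probability factors over the pairs, and the free
    ones contribute 1.\<close>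
  have "measure_pmf.prob (null_law N p) {W. clique K (edges N W)} =
          measure_pmf.prob (Pi_pmf (node_pairs N) False (\<lambda>_. bernoulli_pmf p))
            (Pi (node_pairs N) (\<lambda>e. if e \<in> ?I then {True} else UNIV))"
    unfolding null_law_def graph_law_def measure_map_pmf
    using sub
    by (intro arg_cong[where f = "measure_pmf.prob _"])
       (auto simp: clique_sym_matrix_iff[OF assms(1)] Pi_def)
  also have "\<dots> = (\<Prod>e\<in>node_pairs N.
      measure_pmf.prob (bernoulli_pmf p) (if e \<in> ?I then {True} else UNIV))"
    by (rule measure_Pi_pmf_Pi[OF finite_node_pairs])
  also have "\<dots> = (\<Prod>e\<in>node_pairs N. if e \<in> ?I then p else 1)"
    using assms by (intro prod.cong) (auto simp: measure_pmf_single)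
  also have "\<dots> = (\<Prod>e\<in>?I. p)"
    using sub finite_node_pairs by (intro prod.mono_neutral_cong_right) auto
  also have "\<dots> = p ^ (card K * (card K - 1) div 2)"
    using card_increasing_pairs[of K] finite_subset[OF assms(1)] by simp
  finally show ?thesis .
qed

lemma prob_null_clique_number_ge:
  assumes "0 \<le> p" "p \<le> 1"
  shows "measure_pmf.prob (null_law N p) {W. clique_number N W \<ge> n} \<le>
           real (N choose n) * p ^ (n * (n - 1) div 2)"
proof -
  let ?\<K> = "{K. K \<subseteq> {1..N} \<and> card K = n}"
  have "measure_pmf.prob (null_law N p) {W. clique_number N W \<ge> n} =
          measure_pmf.prob (null_law N p) (\<Union>K\<in>?\<K>. {W. clique K (edges N W)})"
    by (intro arg_cong[where f = "measure_pmf.prob _"]) (auto simp: clique_number_ge_iff)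
  also have "\<dots> \<le> (\<Sum>K\<in>?\<K>. measure_pmf.prob (null_law N p) {W. clique K (edges N W)})"
    by (intro measure_pmf.finite_measure_subadditive_finite) auto
  also have "\<dots> = (\<Sum>K\<in>?\<K>. p ^ (n * (n - 1) div 2))"
    using prob_null_clique assms by (intro sum.cong) auto
  also have "\<dots> = real (N choose n) * p ^ (n * (n - 1) div 2)"
    by (simp add: n_subsets)
  finally show ?thesis .
qed

text \<open>The argument is on the support: a Bernoulli variable with parameter 1 gives
  \<open>False\<close> no mass, so every matrix in the support has S as a clique.\<close>

lemma prob_clique_law_clique_number_less:
  assumes "S \<subseteq> {1..N}"
  shows "measure_pmf.prob (clique_law N p S) {W. clique_number N W < card S} = 0"
proof -
  let ?q = "\<lambda>(i, j). if i \<in> S \<and> j \<in> S then 1 else p"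
  have "clique_number N W \<ge> card S" if W: "W \<in> set_pmf (clique_law N p S)" for W
  proof -
    from W obtain \<omega> where \<omega>: "W = sym_matrix \<omega>"
        "\<omega> \<in> set_pmf (Pi_pmf (node_pairs N) False (\<lambda>e. bernoulli_pmf (?q e)))"
      by (auto simp: clique_law_def graph_law_def)
    have "\<omega> e" if e: "e \<in> increasing_pairs S" for e
    proof -
      have "e \<in> node_pairs N"
        using e increasing_pairs_subset_node_pairs[OF assms] by blast
      then have "\<omega> e \<in> set_pmf (bernoulli_pmf (?q e))"
        using \<omega>(2) unfolding set_Pi_pmf[OF finite_node_pairs] PiE_dflt_def comp_def by blast
      moreover have "?q e = 1"
        using e by (auto simp: increasing_pairs_def)
      ultimately show ?thesis
        by (simp add: set_pmf_iff split: bool.splits) (cases "\<omega> e"; simp)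
    qed
    then show ?thesis
      using assms \<omega>(1) clique_sym_matrix_iff[OF assms] clique_number_ge_iff by blast
  qed
  then show ?thesis
    by (subst measure_pmf_zero_iff) (auto simp: disjoint_iff not_less)
qed

text \<open>The bound n \<le> N makes the family of n-sets nonempty, so that \<open>Max\<close>
  dominates an actual probability instead of being unspecified.\<close>

lemma risk_nonneg:
  assumes "n \<le> N"
  shows "0 \<le> risk N n p T"
proof -
  let ?\<K> = "{S. S \<subseteq> {1..N} \<and> card S = n}"
  have "{1..n} \<in> ?\<K>"
    using assms by auto
  then have "measure_pmf.prob (clique_law N p {1..n}) {W. T W = 0} \<le>
      (MAX S\<in>?\<K>. measure_pmf.prob (clique_law N p S) {W. T W = 0})"
    by (intro Max_ge) auto
  then have "0 \<le> (MAX S\<in>?\<K>. measure_pmf.prob (clique_law N p S) {W. T W = 0})"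
    using measure_nonneg order_trans by blast
  then show ?thesis
    by (simp add: risk_def)
qed

lemma risk_clique_number_test_le:
  assumes "n \<le> N" "0 \<le> p" "p \<le> 1"
  shows "risk N n p (clique_number_test N n) \<le> real (N choose n) * p ^ (n * (n - 1) div 2)"
proof -
  let ?\<K> = "{S. S \<subseteq> {1..N} \<and> card S = n}"
  have ne: "{1..n} \<in> ?\<K>"
    using assms(1) by auto
  have type2: "measure_pmf.prob (clique_law N p S) {W. clique_number_test N n W = 0} = 0"
    if "S \<in> ?\<K>" for S
    using that prob_clique_law_clique_number_less[of S N p]
    by (auto simp: clique_number_test_def not_le)
  \<comment> \<open>Only the upper bound 0 on the worst missed-detection probability is required;
    the whole risk is then bounded by the null term.\<close>
  have "(MAX S\<in>?\<K>. measure_pmf.prob (clique_law N p S) {W. clique_number_test N n W = 0}) \<le> 0"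
  proof (rule Max.boundedI)
    show "(\<lambda>S. measure_pmf.prob (clique_law N p S) {W. clique_number_test N n W = 0}) ` ?\<K> \<noteq> {}"
      using ne by blast
  qed (use type2 in auto)
  moreover have "{W. clique_number_test N n W = 1} = {W. clique_number N W \<ge> n}"
    by (auto simp: clique_number_test_def)
  ultimately show ?thesis
    using prob_null_clique_number_ge[OF assms(2,3), of N n] by (simp add: risk_def)
qed

theorem proposition1:
  fixes n :: "nat \<Rightarrow> nat" and p0 :: "nat \<Rightarrow> real"
  assumes p0_range: "\<And>N. 0 < p0 N \<and> p0 N < 1"
    and p0_bounded_away: "\<exists>\<epsilon>>0. \<forall>N. p0 N \<le> 1 - \<epsilon>"
    and n_small: "(\<lambda>N. real (n N) / real N) \<longlonglongrightarrow> 0"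
    and many_edges: "filterlim (\<lambda>N. (real N)\<^sup>2 * p0 N) at_top sequentially"
    and clique_cond: "(\<lambda>N. real (N choose n N) * p0 N ^ (n N * (n N - 1) div 2)) \<longlonglongrightarrow> 0"
  shows "\<exists>c :: nat \<Rightarrow> nat.
           (\<lambda>N. risk N (n N) (p0 N) (clique_number_test N (c N))) \<longlonglongrightarrow> 0"
proof -
  \<comment> \<open>A quotient below 1 yields n \<le> N only for positive N, since division by 0
    returns 0; hence N > 0 is added in the next step.\<close>
  have "\<forall>\<^sub>F N in sequentially. real (n N) / real N < 1"
    using order_tendstoD(2)[OF n_small] by simp
  then have le: "\<forall>\<^sub>F N in sequentially. n N \<le> N"
    using eventually_gt_at_top[of 0] by eventually_elim simp
  have "(\<lambda>N. risk N (n N) (p0 N) (clique_number_test N (n N))) \<longlonglongrightarrow> 0"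
  proof (rule tendsto_sandwich[OF _ _ tendsto_const clique_cond])
    show "\<forall>\<^sub>F N in sequentially. 0 \<le> risk N (n N) (p0 N) (clique_number_test N (n N))"
      using le by eventually_elim (rule risk_nonneg)
    show "\<forall>\<^sub>F N in sequentially. risk N (n N) (p0 N) (clique_number_test N (n N))
            \<le> real (N choose n N) * p0 N ^ (n N * (n N - 1) div 2)"
      using le
    proof eventually_elim
      case (elim N)
      then show ?case
        using p0_range[of N] by (intro risk_clique_number_test_le) auto
    qed
  qed
  then show ?thesis
    by blast
qed

end
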